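(* Let $n\ge 1$ be an integer. The repunit $R(2^n)$ is the product of $n$ pairwise distinct positive integers. Moreover, $R(2^n)$ can be expressed as a product $A\times B$ for at least $M$ pairwise distinct (unordered) polynomial pairs $(A,B)$, where $$M=\begin{cases}\sum_{j=1}^{k}\binom{n}{j}, & \text{if } n=2k+1,\\ \sum_{j=1}^{k-1}\binom{n}{j}+\frac12\binom{n}{k}, & \text{if } n=2k.\end{cases}$$
   Context: For a positive integer $m$, the repunit $R(m)=\sum_{i=0}^{m-1}10^i=\frac{10^m-1}{9}$ is the $m$-digit number all of whose decimal digits are $1$. For a positive integer $A=\sum_{i=0}^a a_i10^i$ in decimal (digits $a_i\in\{0,\dots,9\}$, $a_a\ne0$), let $P(A,x)=\sum_{i=0}^a a_ix^i$. A pair $(A,B)$ of positive integers is a polynomial pair if $P(A,x)P(B,x)=P(A\times B,x)$. *)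

theory Defs
  imports Complex_Main "HOL-Computational_Algebra.Polynomial" "HOL-Library.Uprod"
begin

definition repunit :: "nat \<Rightarrow> nat" where
  "repunit m = (\<Sum>i<m. 10 ^ i)"

(* For A > 0 the index set {i. 10 ^ i \<le> A} is {0..a}, where a is the position of the
   leading decimal digit of A. *)
definition digit_poly :: "nat \<Rightarrow> int poly" where
  "digit_poly A = (\<Sum>i | 10 ^ i \<le> A. monom (int (A div 10 ^ i mod 10)) i)"

definition polynomial_pair :: "nat \<Rightarrow> nat \<Rightarrow> bool" where
  "polynomial_pair A B \<longleftrightarrow>
     0 < A \<and> 0 < B \<and> digit_poly A * digit_poly B = digit_poly (A * B)"

definition polynomial_factorizations :: "nat \<Rightarrow> nat uprod set" where
  "polynomial_factorizations N = {Upair A B | A B. polynomial_pair A B \<and> A * B = N}"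

end

theory Submission
  imports Defs "HOL-Library.Nat_Bijection"
begin

text \<open>
  The telescoping identity \<open>R(2^n) = (10^1 + 1)(10^2 + 1)(10^4 + 1) \<dots>\<close> with \<open>n\<close> factors gives the
  first claim. For the second, split the index set of the factors into two parts \<open>T\<close> and \<open>T'\<close>. By
  uniqueness of binary expansions, each of the two partial products of the polynomials \<open>1 + x^(2^i)\<close>,
  and their full product, has coefficients 0 and 1 only. Such a polynomial is the digit polynomial of
  its value at 10, so \<open>T\<close> and \<open>T'\<close> yield a polynomial pair. The degree of a partial product is the
  sum of the \<open>2^i\<close>, which determines \<open>T\<close>, so the \<open>2^(n-1)\<close> unordered splittings give distinct pairs.
\<close>

text \<open>Past the leading digit \<open>A div 10 ^ i\<close> is 0, so the bound on the index set
  of \<open>digit_poly\<close> disappears.\<close>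

lemma coeff_digit_poly: "coeff (digit_poly A) i = int (A div 10 ^ i mod 10)"
proof -
  have "{i. (10::nat) ^ i \<le> A} \<subseteq> {..A}"
    using power_gt_expt[of "10::nat"] by (fastforce intro: less_imp_le less_le_trans)
  then have fin: "finite {i. (10::nat) ^ i \<le> A}"
    by (rule finite_subset) simp
  show ?thesis
    using fin by (simp add: digit_poly_def coeff_sum coeff_monom sum.delta' not_le)
qed

text \<open>Horner's scheme: the value of \<open>pCons a p\<close> at 10 is
  \<open>a + 10 * poly p 10\<close>, so division by 10 strips off the constant coefficient.\<close>

lemma coeff_eq_digit_of_poly:
  fixes p :: "int poly"
  assumes "\<And>i. coeff p i \<in> {0..<10}"
  shows "coeff p i = poly p 10 div 10 ^ i mod 10"
  using assms
proof (induction p arbitrary: i)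
  case 0
  then show ?case by simp
next
  case (pCons a p)
  have a: "0 \<le> a" "a < 10" using pCons.prems[of 0] by simp_all
  have p: "coeff p i \<in> {0..<10}" for i using pCons.prems[of "Suc i"] by simp
  show ?case
  proof (cases i)
    case 0
    then show ?thesis using a by simp
  next
    case (Suc j)
    have "poly (pCons a p) 10 div 10 ^ i = (a + 10 * poly p 10) div 10 div 10 ^ j"
      by (simp add: Suc div_mult2_eq zdiv_zmult2_eq)
    also have "(a + 10 * poly p 10) div 10 = poly p 10" using a by simp
    finally show ?thesis using pCons.IH[OF p] Suc by simp
  qed
qed

lemma digit_poly_eqI:
  assumes "\<And>i. coeff p i \<in> {0..<10}" and "poly p 10 = int A"
  shows "digit_poly A = p"
proof (rule poly_eqI)
  fix i
  show "coeff (digit_poly A) i = coeff p i"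
    unfolding coeff_digit_poly coeff_eq_digit_of_poly[OF assms(1)] assms(2)
    by (simp add: zdiv_int zmod_int)
qed

definition fermat_poly :: "nat set \<Rightarrow> int poly" where
  "fermat_poly T = (\<Prod>i\<in>T. 1 + monom 1 (2 ^ i))"

definition fermat_prod :: "nat set \<Rightarrow> nat" where
  "fermat_prod T = (\<Prod>i\<in>T. 10 ^ 2 ^ i + 1)"

lemma degree_fermat_poly: "degree (fermat_poly T) = set_encode T"
proof -
  have deg: "degree (1 + monom (1::int) (2 ^ i)) = 2 ^ i" for i
    by (subst degree_add_eq_right) (simp_all add: degree_monom_eq)
  then have "1 + monom (1::int) (2 ^ i) \<noteq> 0" for i
    by (metis degree_0 power_not_zero zero_neq_numeral)
  then show ?thesis
    by (simp add: fermat_poly_def set_encode_def degree_prod_eq_sum_degree deg)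
qed

text \<open>Adding a new largest index \<open>b\<close> to \<open>T\<close> adds a copy of the old
  polynomial shifted by \<open>2 ^ b\<close>. The old degree is below \<open>2 ^ b\<close>, so the
  two copies do not overlap.\<close>

lemma coeff_fermat_poly:
  assumes "finite T"
  shows "coeff (fermat_poly T) m \<in> {0, 1}"
  using assms
proof (induction T arbitrary: m rule: finite_linorder_max_induct)
  case empty
  then show ?case by (cases m) (simp_all add: fermat_poly_def)
next
  case (insert b T)
  have "set_encode T \<le> (\<Sum>i<b. 2 ^ i)"
    unfolding set_encode_def using insert.hyps by (intro sum_mono2) auto
  also have "\<dots> = 2 ^ b - 1"
    by (simp add: mask_eq_sum_exp_nat lessThan_def)
  finally have "degree (fermat_poly T) < 2 ^ b"
    unfolding degree_fermat_poly using zero_less_power[of "2::nat" b] by linarith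
  then have high: "coeff (fermat_poly T) m = 0" if "2 ^ b \<le> m" for m
    using that by (intro coeff_eq_0) simp
  have "fermat_poly (insert b T) = fermat_poly T + monom 1 (2 ^ b) * fermat_poly T"
    using insert.hyps by (subst fermat_poly_def, subst prod.insert)
      (auto simp: fermat_poly_def algebra_simps)
  then have "coeff (fermat_poly (insert b T)) m =
      (if m < 2 ^ b then coeff (fermat_poly T) m else coeff (fermat_poly T) (m - 2 ^ b))"
    by (simp add: coeff_monom_mult high)
  then show ?case using insert.IH by simp
qed

lemma digit_poly_fermat_prod:
  assumes "finite T"
  shows "digit_poly (fermat_prod T) = fermat_poly T"
proof (rule digit_poly_eqI)
  show "coeff (fermat_poly T) i \<in> {0..<10}" for i
    using coeff_fermat_poly[OF assms, of i] by auto
  show "poly (fermat_poly T) 10 = int (fermat_prod T)"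
    by (simp add: fermat_poly_def fermat_prod_def poly_prod poly_monom add.commute)
qed

lemma fermat_prod_pos: "0 < fermat_prod T"
  by (simp add: fermat_prod_def prod_pos)

lemma fermat_prod_Un_disjoint:
  "finite S \<Longrightarrow> finite T \<Longrightarrow> S \<inter> T = {} \<Longrightarrow> fermat_prod (S \<union> T) = fermat_prod S * fermat_prod T"
  by (simp add: fermat_prod_def prod.union_disjoint)

text \<open>Equal numbers have equal digit polynomials, and their degrees are the binary codes
  \<open>set_encode\<close> of the index sets, which is injective on finite sets.\<close>

lemma fermat_prod_inj:
  assumes "finite S" "finite T" "fermat_prod S = fermat_prod T"
  shows "S = T"
  using assms digit_poly_fermat_prod degree_fermat_poly set_encode_eq by metis

lemma polynomial_pair_fermat_prod:
  assumes "finite S" "finite T" "S \<inter> T = {}"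
  shows "polynomial_pair (fermat_prod S) (fermat_prod T)"
  using assms
  by (simp add: polynomial_pair_def fermat_prod_pos fermat_prod_Un_disjoint[symmetric]
      digit_poly_fermat_prod) (simp add: fermat_poly_def prod.union_disjoint)

lemma repunit_power_2: "repunit (2 ^ n) = fermat_prod {..<n}"
proof (induction n)
  case 0
  then show ?case by (simp add: repunit_def fermat_prod_def)
next
  case (Suc n)
  \<comment> \<open>Cutting the string of ones into two equal blocks produces the new factor
    \<open>10 ^ 2 ^ n + 1\<close>.\<close>
  have "repunit (m + l) = repunit m + 10 ^ m * repunit l" for m l
    by (induction l) (simp_all add: repunit_def power_add algebra_simps)
  from this[of "2 ^ n" "2 ^ n"] show ?case
    using Suc by (simp add: fermat_prod_def mult_2 algebra_simps)
qed

text \<open>Lower bounds on \<open>card\<close> need finiteness, since \<open>card\<close> of an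
  infinite set is 0. Both factors divide \<open>N\<close>, hence are at most
  \<open>N\<close>.\<close>

lemma finite_polynomial_factorizations:
  assumes "0 < N"
  shows "finite (polynomial_factorizations N)"
proof (rule finite_subset)
  show "polynomial_factorizations N \<subseteq> (\<lambda>(A, B). Upair A B) ` ({..N} \<times> {..N})"
    by (auto simp: polynomial_factorizations_def polynomial_pair_def image_iff Bex_def)
qed simp

lemma card_polynomial_factorizations_ge:
  "2 ^ m \<le> card (polynomial_factorizations (repunit (2 ^ Suc m)))"
proof -
  \<comment> \<open>Letting \<open>T\<close> range over subsets of \<open>{..<m}\<close> puts the
    top index \<open>m\<close> always into the complement, which selects one representative of each
    unordered splitting.\<close>
  let ?f = "\<lambda>T. Upair (fermat_prod T) (fermat_prod ({..<Suc m} - T))"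
  have fin: "finite T" if "T \<in> Pow {..<m}" for T
    using that finite_subset by auto
  have "inj_on ?f (Pow {..<m})"
  proof (rule inj_onI)
    fix S T
    assume ST: "S \<in> Pow {..<m}" "T \<in> Pow {..<m}" "?f S = ?f T"
    from ST(3) consider "fermat_prod S = fermat_prod T"
      | "fermat_prod S = fermat_prod ({..<Suc m} - T)" by auto
    then show "S = T"
    proof cases
      case 1
      then show ?thesis using fermat_prod_inj fin ST by blast
    next
      case 2
      then have "S = {..<Suc m} - T" using fermat_prod_inj[of S] fin ST by blast
      \<comment> \<open>The swapped case is contradictory: the complement of \<open>T\<close>
        contains \<open>m\<close>, but \<open>S\<close> does not.\<close>
      then show ?thesis using ST by auto
    qed
  qed
  then have "2 ^ m = card (?f ` Pow {..<m})"
    by (simp add: card_image card_Pow)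
  also have "\<dots> \<le> card (polynomial_factorizations (repunit (2 ^ Suc m)))"
  proof (intro card_mono subsetI)
    show "finite (polynomial_factorizations (repunit (2 ^ Suc m)))"
      by (intro finite_polynomial_factorizations) (simp add: repunit_power_2 fermat_prod_pos del: power_Suc)
  next
    fix u
    assume "u \<in> ?f ` Pow {..<m}"
    then obtain T where T: "T \<subseteq> {..<m}" "u = ?f T" by auto
    have "T \<union> ({..<Suc m} - T) = {..<Suc m}" using T by auto
    then have "fermat_prod T * fermat_prod ({..<Suc m} - T) = repunit (2 ^ Suc m)"
      using fermat_prod_Un_disjoint[of T "{..<Suc m} - T"] fin T
      by (simp add: repunit_power_2 del: power_Suc)
    then show "u \<in> polynomial_factorizations (repunit (2 ^ Suc m))"
      using polynomial_pair_fermat_prod[of T "{..<Suc m} - T"] fin T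
      unfolding polynomial_factorizations_def by blast
  qed
  finally show ?thesis .
qed

text \<open>By symmetry the terms with \<open>j \<le> k\<close> make up half of the row sum; the
  term \<open>j = 0\<close> is dropped.\<close>

lemma sum_choose_lower_half_odd: "(\<Sum>j=1..k. (2 * k + 1) choose j) \<le> 2 ^ (2 * k)"
  unfolding binomial_r_part_sum[symmetric] by (rule sum_mono2) auto

text \<open>Half of the central coefficient is \<open>(2k + 1) choose k\<close>; apply Pascal's rule to the others.\<close>

lemma sum_choose_lower_half_even:
  "(\<Sum>j=1..k. real ((2 * k + 2) choose j)) + 1 / 2 * real ((2 * k + 2) choose (k + 1)) \<le> 2 ^ (2 * k + 1)"
proof -
  let ?c = "\<lambda>j. (2 * k + 1) choose j"
  have "?c (Suc k) = ?c k"
    by (subst binomial_symmetric) simp_all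
  then have "real ((2 * k + 2) choose (k + 1)) = 2 * real (?c k)"
    by simp
  moreover have "(\<Sum>j=1..k. (2 * k + 2) choose j) = (\<Sum>i<k. ?c i) + (\<Sum>i<k. ?c (Suc i))"
    by (simp add: sum.atLeast1_atMost_eq sum.distrib)
  moreover have "(\<Sum>i<k. ?c i) + ?c k = 2 ^ (2 * k)"
    using binomial_r_part_sum[of k] by (simp add: lessThan_Suc_atMost[symmetric])
  \<comment> \<open>The \<open>Suc\<close> stands for the term \<open>?c 0 = 1\<close>.\<close>
  moreover have "Suc (\<Sum>i<k. ?c (Suc i)) = 2 ^ (2 * k)"
    using binomial_r_part_sum[of k] by (simp add: sum.atMost_shift)
  ultimately have "(\<Sum>j=1..k. (2 * k + 2) choose j) + ?c k + 1 = 2 ^ (2 * k + 1)"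
    by simp
  then have "real ((\<Sum>j=1..k. (2 * k + 2) choose j) + ?c k + 1) = 2 ^ (2 * k + 1)"
    by (metis of_nat_numeral of_nat_power)
  with \<open>real _ = 2 * real (?c k)\<close> show ?thesis by simp
qed

theorem theorem8:
  fixes n :: nat
  assumes "n \<ge> 1"
  shows "(\<exists>S :: nat set. finite S \<and> card S = n \<and> (\<forall>s\<in>S. 0 < s) \<and> repunit (2 ^ n) = \<Prod>S)
    \<and> (\<forall>k. n = 2 * k + 1 \<longrightarrow>
          real (card (polynomial_factorizations (repunit (2 ^ n)))) \<ge> (\<Sum>j=1..k. real (n choose j)))
    \<and> (\<forall>k. n = 2 * k \<longrightarrow>
          real (card (polynomial_factorizations (repunit (2 ^ n))))
            \<ge> (\<Sum>j=1..k-1. real (n choose j)) + 1 / 2 * real (n choose k))"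
proof (intro conjI allI impI)
  let ?g = "\<lambda>i. 10 ^ 2 ^ i + 1 :: nat"
  have inj: "inj_on ?g {..<n}" by (auto intro!: inj_onI)
  have "repunit (2 ^ n) = \<Prod>(?g ` {..<n})"
    unfolding repunit_power_2 fermat_prod_def prod.reindex[OF inj] by simp
  then show "\<exists>S :: nat set. finite S \<and> card S = n \<and> (\<forall>s\<in>S. 0 < s) \<and> repunit (2 ^ n) = \<Prod>S"
    using card_image[OF inj] by (intro exI[of _ "?g ` {..<n}"]) auto
next
  fix k
  assume "n = 2 * k + 1"
  then have "(\<Sum>j=1..k. n choose j) \<le> card (polynomial_factorizations (repunit (2 ^ n)))"
    using order_trans[OF sum_choose_lower_half_odd card_polynomial_factorizations_ge] by simp
  then show "real (card (polynomial_factorizations (repunit (2 ^ n)))) \<ge> (\<Sum>j=1..k. real (n choose j))"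
    by (simp flip: of_nat_sum)
next
  fix k
  assume n: "n = 2 * k"
  with assms obtain l where k: "k = Suc l" by (cases k) auto
  have "2 ^ (2 * l + 1) \<le> card (polynomial_factorizations (repunit (2 ^ n)))"
    using card_polynomial_factorizations_ge[of "2 * l + 1"] by (simp add: n k)
  then have "real (2 ^ (2 * l + 1)) \<le> real (card (polynomial_factorizations (repunit (2 ^ n))))"
    by (rule of_nat_mono)
  then show "real (card (polynomial_factorizations (repunit (2 ^ n))))
            \<ge> (\<Sum>j=1..k-1. real (n choose j)) + 1 / 2 * real (n choose k)"
    using sum_choose_lower_half_even[of l] by (simp add: n k del: binomial_Suc_Suc)
qed

end
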